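(* Let $(X,d,\mu)$ and $(X',d',\mu')$ be metric measure spaces with $X$ and $X'$ compact, and let $p\ge 1$. Then \[ d_{GH}(M_{\mu,p},M_{\mu',p})\le d_{KS,p}(\mu,\mu'). \]
   Context: A metric measure space $(X,d,\mu)$ is a metric space with a Borel probability measure. $O(X)$ is the set of all 1-Lipschitz functions $f\colon X\to\mathbb{R}$. For $p\ge1$, $O_p(X)$ denotes the bounded pseudo metric space $(O(X),r_{p,\mu})$ with $r_{p,\mu}(f,g)=\left(\int_X|f(x)-g(x)|^p\,d\mu(x)\right)^{1/p}$, and $M_{\mu,p}\colon O_p(X)\to\mathbb{R}$ is the observable mean $M_{\mu,p}(f)=\int_X f\,d\mu$ on this space; similarly for $(X',d',\mu')$. Gromov-Hausdorff distance between functions: let $(Z,d_Z)$, $(Z',d_{Z'})$ be bounded pseudo metric spaces and $f\colon Z\to\mathbb{R}$, $f'\colon Z'\to\mathbb{R}$ continuous. A correspondence is a relation $R\subseteq Z\times Z'$ whose projections to $Z$ and $Z'$ are surjective. Let $dis(R)=\sup_{(z_1,z_1'),(z_2,z_2')\in R}|d_Z(z_1,z_2)-d_{Z'}(z_1',z_2')|$ and $fdis(R)=\sup_{(z,z')\in R}|f(z)-f'(z')|$. Then $d_{GH}(f,f')=\frac12\inf_R\max\{dis(R),2\,fdis(R)\}$, the infimum over all correspondences $R\subseteq Z\times Z'$. Kantorovich-Sturm distance: let $K\subseteq X$, $K'\subseteq X'$ be the supports of $\mu,\mu'$. A metric coupling is a metric $\delta$ on the disjoint union $X\sqcup X'$ with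 $\delta|_{K\times K}=d|_{K\times K}$ and $\delta|_{K'\times K'}=d'|_{K'\times K'}$; the set of these is $C((d,\mu),(d',\mu'))$. $\Gamma(\mu,\mu')$ is the set of Borel probability measures $h$ on $X\times X'$ with marginals $\mu$ and $\mu'$. For $p\ge1$, \[ d_{KS,p}(\mu,\mu')=\inf_{h\in\Gamma(\mu,\mu'),\ \delta\in C((d,\mu),(d',\mu'))}\left(\int_{X\times X'}\delta^p(x,x')\,dh(x,x')\right)^{1/p}, \] where $d_{KS,p}(\mu,\mu')$ abbreviates the distance between the metric measure spaces $(X,d,\mu)$ and $(X',d',\mu')$. Since any $h\in\Gamma(\mu,\mu')$ has support contained in $K\times K'$, integrals over $X\times X'$ against $h$ equal integrals over $K\times K'$. *)

theory Defs
  imports "HOL-Probability.Probability"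
begin

(* The metric d of (X,d,mu) is the class metric dist, and X is the whole type. *)
definition mm_space :: "'a::metric_space measure \<Rightarrow> bool" where
  "mm_space \<mu> \<longleftrightarrow> prob_space \<mu> \<and> sets \<mu> = sets borel"

definition msupport :: "'a::topological_space measure \<Rightarrow> 'a set" where
  "msupport \<mu> = {x. \<forall>U. open U \<longrightarrow> x \<in> U \<longrightarrow> emeasure \<mu> U > 0}"

subsection \<open>Observables\<close>

definition observables :: "('a::metric_space \<Rightarrow> real) set" where
  "observables = {f. 1-lipschitz_on UNIV f}"

(* The integrand is bounded and continuous when X is compact, hence integrable. *)
definition obs_dist ::
    "real \<Rightarrow> 'a::metric_space measure \<Rightarrow> ('a \<Rightarrow> real) \<Rightarrow> ('a \<Rightarrow> real) \<Rightarrow> real" where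
  "obs_dist p \<mu> f g = (\<integral>x. \<bar>f x - g x\<bar> powr p \<partial>\<mu>) powr (1 / p)"

definition obs_mean :: "'a::metric_space measure \<Rightarrow> ('a \<Rightarrow> real) \<Rightarrow> real" where
  "obs_mean \<mu> f = (\<integral>x. f x \<partial>\<mu>)"

subsection \<open>Gromov-Hausdorff distance between functions\<close>

definition correspondences :: "'z set \<Rightarrow> 'w set \<Rightarrow> ('z \<times> 'w) set set" where
  "correspondences Z Z' = {R. R \<subseteq> Z \<times> Z' \<and> fst ` R = Z \<and> snd ` R = Z'}"

(* Distortions take values in [0,\<infinity>]: the observables include all constants, so a
   correspondence between two spaces of observables can have infinite distortion. *)
definition distortion ::
    "('z \<Rightarrow> 'z \<Rightarrow> real) \<Rightarrow> ('w \<Rightarrow> 'w \<Rightarrow> real) \<Rightarrow> ('z \<times> 'w) set \<Rightarrow> ennreal" where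
  "distortion dZ dZ' R =
     (SUP ((z1, w1), (z2, w2)) \<in> R \<times> R. ennreal \<bar>dZ z1 z2 - dZ' w1 w2\<bar>)"

definition fdistortion ::
    "('z \<Rightarrow> real) \<Rightarrow> ('w \<Rightarrow> real) \<Rightarrow> ('z \<times> 'w) set \<Rightarrow> ennreal" where
  "fdistortion f f' R = (SUP (z, w) \<in> R. ennreal \<bar>f z - f' w\<bar>)"

(* A pseudo metric space is given by its carrier Z and its pseudo metric dZ. *)
definition GH_dist ::
    "'z set \<Rightarrow> ('z \<Rightarrow> 'z \<Rightarrow> real) \<Rightarrow> ('z \<Rightarrow> real) \<Rightarrow>
     'w set \<Rightarrow> ('w \<Rightarrow> 'w \<Rightarrow> real) \<Rightarrow> ('w \<Rightarrow> real) \<Rightarrow> ennreal" where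
  "GH_dist Z dZ f Z' dZ' f' =
     (INF R \<in> correspondences Z Z'. max (distortion dZ dZ' R) (2 * fdistortion f f' R)) / 2"

subsection \<open>Kantorovich-Sturm distance\<close>

(* Agreement with the given metrics is required on the supports only. *)
definition metric_couplings ::
    "'a::metric_space measure \<Rightarrow> 'b::metric_space measure \<Rightarrow> ('a + 'b \<Rightarrow> 'a + 'b \<Rightarrow> real) set" where
  "metric_couplings \<mu> \<mu>' = {\<delta>. Metric_space UNIV \<delta> \<and>
     (\<forall>x\<in>msupport \<mu>. \<forall>y\<in>msupport \<mu>. \<delta> (Inl x) (Inl y) = dist x y) \<and>
     (\<forall>x\<in>msupport \<mu>'. \<forall>y\<in>msupport \<mu>'. \<delta> (Inr x) (Inr y) = dist x y)}"

definition measure_couplings ::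
    "'a::metric_space measure \<Rightarrow> 'b::metric_space measure \<Rightarrow> ('a \<times> 'b) measure set" where
  "measure_couplings \<mu> \<mu>' = {h. prob_space h \<and> sets h = sets borel \<and>
     distr h borel fst = \<mu> \<and> distr h borel snd = \<mu>'}"

(* The p-th power on [0,\<infinity>], for p > 0. *)
definition ennreal_powr :: "ennreal \<Rightarrow> real \<Rightarrow> ennreal" where
  "ennreal_powr x p = (if x = \<top> then \<top> else ennreal (enn2real x powr p))"

(* Off the product of the supports \<delta> need not be Borel measurable.  For compact spaces this
   does no harm: h is concentrated on that product, and since nn_integral is a supremum over
   simple functions below the integrand, it is insensitive to null sets even for
   non-measurable integrands.  A Bochner integral would default to 0 instead. *)
definition KS_dist :: "real \<Rightarrow> 'a::metric_space measure \<Rightarrow> 'b::metric_space measure \<Rightarrow> ennreal" where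
  "KS_dist p \<mu> \<mu>' =
     (INF (h, \<delta>) \<in> measure_couplings \<mu> \<mu>' \<times> metric_couplings \<mu> \<mu>'.
        ennreal_powr (\<integral>\<^sup>+ (x, x'). ennreal (\<delta> (Inl x) (Inr x') powr p) \<partial>h) (1 / p))"

end

theory Submission
  imports Defs
begin

text \<open>
  Let \<open>h\<close> be a coupling of the measures and \<open>\<delta>\<close> a coupling of the metrics, with
  \<open>D = (\<integral> \<delta> powr p dh) powr (1 / p)\<close> finite. Relate an observable \<open>f\<close> of the first space to an
  observable \<open>g\<close> of the second one when \<open>\<bar>f x - g x'\<bar> \<le> \<delta> x x'\<close> for all \<open>x\<close>, \<open>x'\<close> in the supports.
  It suffices to see that this relation \<open>coupled_observables\<close> is a correspondence, that its
  distortion is at most \<open>2 * D\<close>, and that the observable means differ along it by at most \<open>D\<close>.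

  It is a correspondence because \<open>f\<close>, restricted to the support, is 1-Lipschitz for \<open>\<delta>\<close>, so the
  McShane formula extends it to the other support, and once more to the whole other space
  (\<open>observable_extension\<close>).

  For the two estimates, pull all observables back to the product: since the marginals of \<open>h\<close> are
  the given measures, the pseudo metrics become \<open>L\<^sup>p(h)\<close> distances and the means become
  \<open>h\<close>-integrals. The coupling \<open>h\<close> is concentrated on the product of the supports, hence related
  observables are at \<open>L\<^sup>p(h)\<close> distance at most \<open>D\<close> (\<open>coupled_Lp_norm_le_cost\<close>). The triangle
  inequality for the quadrilateral \<open>f\<close>, \<open>g\<close>, \<open>g2\<close>, \<open>f2\<close> bounds the distortion by \<open>2 * D\<close>
  (\<open>obs_dist_diff_le_cost\<close>), and comparing \<open>L\<^sup>1\<close> with \<open>L\<^sup>p\<close> bounds the difference of the means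
  by \<open>D\<close> (\<open>obs_mean_diff_le_cost\<close>).
\<close>

section \<open>Minkowski and Jensen inequalities\<close>

definition Lp_norm :: "real \<Rightarrow> 'c measure \<Rightarrow> ('c \<Rightarrow> real) \<Rightarrow> real" where
  "Lp_norm p M u = (\<integral>x. \<bar>u x\<bar> powr p \<partial>M) powr (1 / p)"

lemma Lp_norm_nonneg: "Lp_norm p M u \<ge> 0"
  by (simp add: Lp_norm_def)

lemma Lp_norm_minus_commute:
  "Lp_norm p M (\<lambda>x. u x - v x) = Lp_norm p M (\<lambda>x. v x - u x)"
  by (simp add: Lp_norm_def abs_minus_commute)

lemma integral_le_powr_of_Lp_norm_le:
  assumes "p > 0" and "Lp_norm p M u \<le> A"
  shows "(\<integral>x. \<bar>u x\<bar> powr p \<partial>M) \<le> A powr p"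
proof -
  have "(\<integral>x. \<bar>u x\<bar> powr p \<partial>M) = Lp_norm p M u powr p"
    using assms(1) by (simp add: Lp_norm_def powr_powr)
  also have "\<dots> \<le> A powr p"
    using assms Lp_norm_nonneg[of p M u] by (intro powr_mono2) auto
  finally show ?thesis .
qed

lemma Lp_norm_le_of_integral_le_powr:
  assumes "p > 0" and "A \<ge> 0" and "(\<integral>x. \<bar>u x\<bar> powr p \<partial>M) \<le> A powr p"
  shows "Lp_norm p M u \<le> A"
proof -
  have "Lp_norm p M u \<le> (A powr p) powr (1 / p)"
    unfolding Lp_norm_def using assms by (intro powr_mono2) auto
  also have "\<dots> = A"
    using assms by (simp add: powr_powr)
  finally show ?thesis .
qed

text \<open>Convexity on the open half-line is \<open>powr_convex\<close>; for segments that start at 0 convexity amounts to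
  \<open>(s * z) powr p \<le> s * z powr p\<close> for \<open>0 < s < 1\<close>, that is, \<open>s powr p \<le> s\<close>.\<close>

lemma convex_on_powr_atLeast_0:
  fixes p :: real
  assumes "p \<ge> 1"
  shows "convex_on {0..} (\<lambda>x. x powr p)"
proof (rule convex_onI)
  fix t x y :: real
  assume t: "0 < t" "t < 1" and xy: "x \<in> {0..}" "y \<in> {0..}"
  have shrink: "(s * z) powr p \<le> s * z powr p" if "0 < s" "s < 1" "0 \<le> z" for s z :: real
  proof -
    have "s powr p \<le> s powr 1"
      using that assms by (intro powr_mono') auto
    then show ?thesis
      using that by (simp add: powr_mult mult_right_mono)
  qed
  consider "x = 0" | "y = 0" | "x > 0" "y > 0"
    using xy by force
  then show "((1 - t) *\<^sub>R x + t *\<^sub>R y) powr p \<le> (1 - t) * x powr p + t * y powr p"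
  proof cases
    case 3
    then show ?thesis
      using convex_onD[OF powr_convex[OF assms], of t x y] t by auto
  qed (use shrink[of t y] shrink[of "1 - t" x] t xy assms in auto)
qed simp

text \<open>Convexity of the power at \<open>a / A\<close> and \<open>b / B\<close>, whose average with weights proportional to \<open>A\<close> and
  \<open>B\<close> is \<open>(a + b) / (A + B)\<close>. Integrating this with \<open>A\<close> and \<open>B\<close> bounds on two norms gives
  Minkowski's inequality.\<close>

lemma powr_add_le_weighted:
  fixes a b A B p :: real
  assumes "p \<ge> 1" "A > 0" "B > 0" "a \<ge> 0" "b \<ge> 0"
  shows "(a + b) powr p \<le>
    (A + B) powr p * (A / (A + B) * (a powr p / A powr p) + B / (A + B) * (b powr p / B powr p))"
proof -
  define t where "t = B / (A + B)"
  have t: "0 \<le> t" "t \<le> 1" and t': "1 - t = A / (A + B)"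
    using assms by (auto simp: t_def field_simps)
  have "((1 - t) * (a / A) + t * (b / B)) powr p \<le> (1 - t) * (a / A) powr p + t * (b / B) powr p"
    using convex_onD[OF convex_on_powr_atLeast_0[OF assms(1)], of t "a / A" "b / B"] t assms
    by auto
  moreover have "a + b = (A + B) * ((1 - t) * (a / A) + t * (b / B))"
    unfolding t' unfolding t_def using assms by (simp add: distrib_left)
  then have "(a + b) powr p = (A + B) powr p * ((1 - t) * (a / A) + t * (b / B)) powr p"
    using assms t by (metis powr_mult)
  ultimately show ?thesis
    unfolding t' unfolding t_def using assms by (simp add: powr_divide mult_left_mono)
qed

text \<open>Stated with upper bounds \<open>A\<close>, \<open>B\<close> instead of the norms themselves, so that the division by \<open>A\<close>
  and \<open>B\<close> is harmless when a norm vanishes.\<close>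

lemma Minkowski_powr:
  fixes u v :: "'c \<Rightarrow> real"
  assumes p: "p \<ge> 1" and A: "A > 0" and B: "B > 0"
    and u: "integrable M (\<lambda>x. \<bar>u x\<bar> powr p)"
      "(\<integral>x. \<bar>u x\<bar> powr p \<partial>M) \<le> A powr p"
    and v: "integrable M (\<lambda>x. \<bar>v x\<bar> powr p)"
      "(\<integral>x. \<bar>v x\<bar> powr p \<partial>M) \<le> B powr p"
  shows "(\<integral>x. \<bar>u x + v x\<bar> powr p \<partial>M) \<le> (A + B) powr p"
proof -
  define w where "w = (\<lambda>x. (A + B) powr p *
      (A / (A + B) * (\<bar>u x\<bar> powr p / A powr p) + B / (A + B) * (\<bar>v x\<bar> powr p / B powr p)))"
  have le: "\<bar>u x + v x\<bar> powr p \<le> w x" for x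
  proof -
    have "\<bar>u x + v x\<bar> powr p \<le> (\<bar>u x\<bar> + \<bar>v x\<bar>) powr p"
      using p by (intro powr_mono2) auto
    also have "\<dots> \<le> w x"
      unfolding w_def by (rule powr_add_le_weighted) (use p A B in auto)
    finally show ?thesis .
  qed
  have w: "integrable M w"
    unfolding w_def using u v by (intro integrable_mult_right integrable_add integrable_divide) auto
  have "(\<integral>x. \<bar>u x + v x\<bar> powr p \<partial>M) \<le> (\<integral>x. w x \<partial>M)"
    using le by (intro integral_mono' w) (auto intro: order.trans[OF powr_ge_zero])
  also have "\<dots> = (A + B) powr p * (A / (A + B) * ((\<integral>x. \<bar>u x\<bar> powr p \<partial>M) / A powr p)
      + B / (A + B) * ((\<integral>x. \<bar>v x\<bar> powr p \<partial>M) / B powr p))"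
    unfolding w_def using u v by simp
  also have "\<dots> \<le> (A + B) powr p * (A / (A + B) * 1 + B / (A + B) * 1)"
    using A B u(2) v(2) by (intro mult_left_mono add_mono) auto
  also have "\<dots> = (A + B) powr p"
    using A B by (simp flip: add_divide_distrib)
  finally show ?thesis .
qed

lemma Lp_norm_triangle:
  fixes u v :: "'c \<Rightarrow> real"
  assumes p: "p \<ge> 1"
    and u: "integrable M (\<lambda>x. \<bar>u x\<bar> powr p)"
    and v: "integrable M (\<lambda>x. \<bar>v x\<bar> powr p)"
  shows "Lp_norm p M (\<lambda>x. u x + v x) \<le> Lp_norm p M u + Lp_norm p M v"
proof (rule field_le_epsilon)
  fix e :: real
  assume e: "e > 0"
  \<comment> \<open>Strictly positive bounds, also when a norm is 0.\<close>
  define A where "A = Lp_norm p M u + e / 2"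
  define B where "B = Lp_norm p M v + e / 2"
  have AB: "A > 0" "B > 0"
    using e Lp_norm_nonneg[of p M u] Lp_norm_nonneg[of p M v] by (auto simp: A_def B_def)
  have "(\<integral>x. \<bar>u x + v x\<bar> powr p \<partial>M) \<le> (A + B) powr p"
    using p e by (intro Minkowski_powr p u v AB integral_le_powr_of_Lp_norm_le)
      (auto simp: A_def B_def)
  then have "Lp_norm p M (\<lambda>x. u x + v x) \<le> A + B"
    using AB p by (intro Lp_norm_le_of_integral_le_powr) auto
  then show "Lp_norm p M (\<lambda>x. u x + v x) \<le> Lp_norm p M u + Lp_norm p M v + e"
    by (simp add: A_def B_def)
qed

text \<open>Young's inequality for \<open>t\<close> and 1. Integrating it for \<open>t = \<bar>u x\<bar> / A\<close>, where \<open>A\<close> bounds the \<open>L\<^sup>p\<close>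
  norm, bounds the \<open>L\<^sup>1\<close> norm of \<open>u\<close> on a probability space.\<close>

lemma le_powr_convex_combination:
  fixes t p :: real
  assumes "p \<ge> 1" "t \<ge> 0"
  shows "t \<le> t powr p / p + (1 - 1 / p)"
proof (cases "t = 0")
  case False
  then have "(t powr p) powr (1 / p) * 1 powr (1 - 1 / p) \<le> 1 / p * (t powr p) + (1 - 1 / p) * 1"
    using assms by (intro Youngs_inequality_0) auto
  then show ?thesis
    using assms False by (simp add: powr_powr)
qed (use assms in auto)

lemma (in prob_space) abs_expectation_le_Lp_norm:
  fixes u :: "'a \<Rightarrow> real"
  assumes p: "p \<ge> 1" and u: "integrable M u" "integrable M (\<lambda>x. \<bar>u x\<bar> powr p)"
  shows "\<bar>expectation u\<bar> \<le> Lp_norm p M u"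
proof (rule field_le_epsilon)
  fix e :: real
  assume e: "e > 0"
  define A where "A = Lp_norm p M u + e"
  have A: "A > 0"
    using e Lp_norm_nonneg[of p M u] by (auto simp: A_def)
  have int: "(\<integral>x. \<bar>u x\<bar> powr p \<partial>M) \<le> A powr p"
    using p e by (intro integral_le_powr_of_Lp_norm_le) (auto simp: A_def)
  have le: "\<bar>u x\<bar> \<le> A * (\<bar>u x\<bar> powr p / A powr p / p + (1 - 1 / p))" for x
    using le_powr_convex_combination[OF p, of "\<bar>u x\<bar> / A"] A
    by (simp add: powr_divide field_simps)
  have "\<bar>expectation u\<bar> \<le> (\<integral>x. \<bar>u x\<bar> \<partial>M)"
    by (rule integral_abs_bound)
  also have "\<dots> \<le> (\<integral>x. A * (\<bar>u x\<bar> powr p / A powr p / p + (1 - 1 / p)) \<partial>M)"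
    using u by (intro integral_mono le) auto
  also have "\<dots> = A * ((\<integral>x. \<bar>u x\<bar> powr p \<partial>M) / A powr p / p + (1 - 1 / p))"
    using u by (simp add: prob_space)
  also have "\<dots> \<le> A * (1 / p + (1 - 1 / p))"
    using A p int by (intro mult_left_mono add_right_mono divide_right_mono) auto
  finally show "\<bar>expectation u\<bar> \<le> Lp_norm p M u + e"
    by (simp add: A_def)
qed

text \<open>The upper bound is a \<open>nn_integral\<close>, which is monotone even when \<open>w\<close> is not measurable; the role of
  \<open>w\<close> is played by a metric coupling, which may fail to be Borel off the product of the supports.\<close>

lemma Lp_norm_le_nn_integral:
  fixes u :: "'c \<Rightarrow> real" and w :: "'c \<Rightarrow> real"
  assumes "p > 0" and "u \<in> borel_measurable M" and "AE z in M. \<bar>u z\<bar> \<le> w z"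
    and "(\<integral>\<^sup>+ z. ennreal (w z powr p) \<partial>M) \<noteq> \<top>"
  shows "Lp_norm p M u \<le> enn2real (\<integral>\<^sup>+ z. ennreal (w z powr p) \<partial>M) powr (1 / p)"
proof -
  have "(\<integral>\<^sup>+ z. ennreal (\<bar>u z\<bar> powr p) \<partial>M) \<le> (\<integral>\<^sup>+ z. ennreal (w z powr p) \<partial>M)"
    using assms(3) by (intro nn_integral_mono_AE, eventually_elim)
      (use assms(1) in \<open>auto intro!: ennreal_leI powr_mono2\<close>)
  moreover have "(\<integral>z. \<bar>u z\<bar> powr p \<partial>M) = enn2real (\<integral>\<^sup>+ z. ennreal (\<bar>u z\<bar> powr p) \<partial>M)"
    using assms(2) by (intro integral_eq_nn_integral) auto
  ultimately have "(\<integral>z. \<bar>u z\<bar> powr p \<partial>M) \<le> enn2real (\<integral>\<^sup>+ z. ennreal (w z powr p) \<partial>M)"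
    using assms(4) by (simp add: enn2real_mono top.not_eq_extremum)
  then show ?thesis
    unfolding Lp_norm_def using assms(1) by (intro powr_mono2) auto
qed

section \<open>The support of a measure on a compact metric space\<close>

text \<open>Finitely many of the null open sets that avoid the support already cover \<open>C\<close>.\<close>

lemma emeasure_compact_disjoint_msupport:
  fixes \<mu> :: "'a::metric_space measure"
  assumes "sets \<mu> = sets borel" "compact C" "C \<inter> msupport \<mu> = {}"
  shows "emeasure \<mu> C = 0"
proof -
  have "\<forall>x\<in>C. \<exists>U. open U \<and> x \<in> U \<and> emeasure \<mu> U = 0"
  proof
    fix x
    assume "x \<in> C"
    then have "x \<notin> msupport \<mu>"
      using assms(3) by blast
    then show "\<exists>U. open U \<and> x \<in> U \<and> emeasure \<mu> U = 0"
      by (auto simp: msupport_def zero_less_iff_neq_zero)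
  qed
  then obtain U where U: "\<And>x. x \<in> C \<Longrightarrow> open (U x) \<and> x \<in> U x \<and> emeasure \<mu> (U x) = 0"
    by metis
  obtain D where D: "D \<subseteq> C" "finite D" "C \<subseteq> (\<Union>x\<in>D. U x)"
    using compactE_image[OF assms(2), of C U] U by (metis UN_I subsetI)
  have sets: "U x \<in> sets \<mu>" if "x \<in> D" for x
    using U D(1) that assms(1) by auto
  have "emeasure \<mu> C \<le> emeasure \<mu> (\<Union>x\<in>D. U x)"
    using D sets by (intro emeasure_mono) auto
  also have "\<dots> \<le> (\<Sum>x\<in>D. emeasure \<mu> (U x))"
    using D sets by (intro emeasure_subadditive_finite) auto
  also have "\<dots> = 0"
    using U D(1) by (intro sum.neutral) auto
  finally show ?thesis
    by simp
qed

lemma msupport_nonempty: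
  fixes \<mu> :: "'a::metric_space measure"
  assumes "mm_space \<mu>" "compact (UNIV :: 'a set)"
  shows "msupport \<mu> \<noteq> {}"
proof
  assume "msupport \<mu> = {}"
  then have "emeasure \<mu> UNIV = 0"
    using assms by (intro emeasure_compact_disjoint_msupport) (auto simp: mm_space_def)
  moreover have "space \<mu> = UNIV"
    using assms sets_eq_imp_space_eq[of \<mu> borel] by (auto simp: mm_space_def)
  ultimately show False
    using prob_space.emeasure_space_1[of \<mu>] assms(1) by (auto simp: mm_space_def)
qed

lemma closed_msupport: "closed (msupport \<mu>)"
proof -
  have "- msupport \<mu> = \<Union>{U. open U \<and> emeasure \<mu> U = 0}"
    by (auto simp: msupport_def)
  then show ?thesis
    by (auto simp: closed_def)
qed

text \<open>The complement of the support is the union of the closed, hence compact, sets of points at distance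
  at least \<open>1 / (n + 1)\<close> from the support, and each of them is null.\<close>

lemma AE_msupport:
  fixes \<mu> :: "'a::metric_space measure"
  assumes \<mu>: "mm_space \<mu>" and cpt: "compact (UNIV :: 'a set)"
  shows "AE x in \<mu>. x \<in> msupport \<mu>"
proof -
  have sets: "sets \<mu> = sets borel"
    using \<mu> by (simp add: mm_space_def)
  define F where "F n = {x. infdist x (msupport \<mu>) \<ge> 1 / Suc n}" for n :: nat
  have closed: "closed (F n)" for n
    unfolding F_def by (intro closed_Collect_le continuous_intros)
  have "F n \<in> null_sets \<mu>" for n
  proof (rule null_setsI)
    have "compact (F n)"
      using compact_Int_closed[OF cpt closed, of n] by simp
    moreover have "F n \<inter> msupport \<mu> = {}"
      by (auto simp: F_def)
    ultimately show "emeasure \<mu> (F n) = 0"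
      using emeasure_compact_disjoint_msupport[OF sets] by blast
    show "F n \<in> sets \<mu>"
      using sets closed by auto
  qed
  then have "(\<Union>n. F n) \<in> null_sets \<mu>"
    by auto
  moreover have "{x \<in> space \<mu>. x \<notin> msupport \<mu>} \<subseteq> (\<Union>n. F n)"
  proof
    fix x
    assume "x \<in> {x \<in> space \<mu>. x \<notin> msupport \<mu>}"
    then have "infdist x (msupport \<mu>) > 0"
      using infdist_pos_not_in_closed[OF closed_msupport msupport_nonempty[OF \<mu> cpt]] by auto
    then obtain n where "1 / real (Suc n) < infdist x (msupport \<mu>)"
      by (rule nat_approx_posE)
    then have "x \<in> F n"
      by (simp add: F_def)
    then show "x \<in> (\<Union>n. F n)"
      by blast
  qed
  ultimately show ?thesis
    by (rule AE_I')
qed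

section \<open>Extending observables across a metric coupling\<close>

definition coupled_observables ::
    "'a::metric_space measure \<Rightarrow> 'b::metric_space measure \<Rightarrow> ('a + 'b \<Rightarrow> 'a + 'b \<Rightarrow> real)
      \<Rightarrow> (('a \<Rightarrow> real) \<times> ('b \<Rightarrow> real)) set" where
  "coupled_observables \<mu> \<mu>' \<delta> = {(f, g). f \<in> observables \<and> g \<in> observables \<and>
     (\<forall>x\<in>msupport \<mu>. \<forall>y\<in>msupport \<mu>'. \<bar>f x - g y\<bar> \<le> \<delta> (Inl x) (Inr y))}"

lemma bounded_observable:
  fixes f :: "'a::metric_space \<Rightarrow> real"
  assumes "f \<in> observables" "compact (UNIV :: 'a set)"
  shows "\<exists>b. \<forall>x. \<bar>f x\<bar> \<le> b"
proof -
  have "bounded (range f)"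
    using assms by (intro compact_imp_bounded compact_continuous_image lipschitz_on_continuous_on)
      (auto simp: observables_def)
  then show ?thesis
    by (auto simp: bounded_iff)
qed

text \<open>The McShane formula \<open>g z = INF (x, y). f x + c x y + dist y z\<close>. The term \<open>dist y z\<close> makes \<open>g\<close>
  1-Lipschitz on the whole type, although \<open>c\<close> is compatible with the metrics on \<open>K\<close> and \<open>K'\<close> only.
  The function \<open>c\<close> stands for the cross distances of a metric coupling; leaving out the rest of the
  coupling lets the lemma serve both directions of the correspondence.\<close>

lemma observable_extension:
  fixes f :: "'a::metric_space \<Rightarrow> real" and c :: "'a \<Rightarrow> 'b::metric_space \<Rightarrow> real"
  assumes K: "K \<noteq> {}" "K' \<noteq> {}" and cpt: "compact (UNIV :: 'a set)"
    and f: "f \<in> observables"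
    and nonneg: "\<And>x y. c x y \<ge> 0"
    and tri1: "\<And>x x' y. x \<in> K \<Longrightarrow> x' \<in> K \<Longrightarrow> y \<in> K' \<Longrightarrow> dist x x' \<le> c x y + c x' y"
    and tri2: "\<And>x y y'. x \<in> K \<Longrightarrow> y \<in> K' \<Longrightarrow> y' \<in> K' \<Longrightarrow> c x y' \<le> c x y + dist y y'"
  obtains g where "g \<in> observables" and "\<And>x y. x \<in> K \<Longrightarrow> y \<in> K' \<Longrightarrow> \<bar>f x - g y\<bar> \<le> c x y"
proof
  have f_lip: "\<bar>f x - f y\<bar> \<le> dist x y" for x y
    using f lipschitz_onD[of 1 UNIV f x y] by (auto simp: observables_def dist_real_def)
  obtain b where "\<forall>x. \<bar>f x\<bar> \<le> b"
    using bounded_observable[OF f cpt] by blast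
  \<comment> \<open>Without a lower bound the infimum below would be a default value.\<close>
  then have b: "- b \<le> f x" for x
    by (metis abs_le_D2 minus_le_iff)
  define g where "g z = (INF (x, y) \<in> K \<times> K'. f x + c x y + dist y z)" for z
  have bdd: "bdd_below ((\<lambda>(x, y). f x + c x y + dist y z) ` (K \<times> K'))" for z
    by (rule bdd_belowI[of _ "- b"]) (use b nonneg in \<open>force intro!: add_increasing2\<close>)
  have upper: "g z \<le> f x + c x y + dist y z" if "x \<in> K" "y \<in> K'" for x y z
    unfolding g_def using cINF_lower[OF bdd, of "(x, y)" z] that by auto
  have lower: "a \<le> g z" if "\<And>x y. x \<in> K \<Longrightarrow> y \<in> K' \<Longrightarrow> a \<le> f x + c x y + dist y z" for a z
    unfolding g_def using K that by (intro cINF_greatest) auto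
  have "g z - dist z w \<le> g w" for z w
  proof (rule lower)
    fix x y
    assume "x \<in> K" "y \<in> K'"
    then show "g z - dist z w \<le> f x + c x y + dist y w"
      using upper[of x y z] dist_triangle3[of y z w] by (simp add: dist_commute)
  qed
  then have "\<bar>g z - g w\<bar> \<le> dist z w" for z w
    by (smt (verit) dist_commute)
  then show "g \<in> observables"
    by (auto simp: observables_def dist_real_def intro!: lipschitz_onI)
  show "\<bar>f x - g y\<bar> \<le> c x y" if x: "x \<in> K" and y: "y \<in> K'" for x y
  proof -
    have "f x - c x y \<le> g y"
    proof (rule lower)
      fix x' y'
      assume *: "x' \<in> K" "y' \<in> K'"
      show "f x - c x y \<le> f x' + c x' y' + dist y' y"
        using f_lip[of x x'] tri1[OF x *(1) y] tri2[OF * y] by linarith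
    qed
    then show ?thesis
      using upper[OF x y, of y] by auto
  qed
qed

lemma coupled_observables_correspondence:
  fixes \<mu> :: "'a::metric_space measure" and \<mu>' :: "'b::metric_space measure"
  assumes \<mu>: "mm_space \<mu>" "mm_space \<mu>'"
    and cpt: "compact (UNIV :: 'a set)" "compact (UNIV :: 'b set)"
    and \<delta>: "\<delta> \<in> metric_couplings \<mu> \<mu>'"
  shows "coupled_observables \<mu> \<mu>' \<delta> \<in> correspondences observables observables"
proof -
  interpret Metric_space UNIV \<delta>
    using \<delta> by (simp add: metric_couplings_def)
  have dist: "\<And>x y. x \<in> msupport \<mu> \<Longrightarrow> y \<in> msupport \<mu> \<Longrightarrow> dist x y = \<delta> (Inl x) (Inl y)"
    "\<And>x y. x \<in> msupport \<mu>' \<Longrightarrow> y \<in> msupport \<mu>' \<Longrightarrow> dist x y = \<delta> (Inr x) (Inr y)"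
    using \<delta> by (auto simp: metric_couplings_def)
  \<comment> \<open>The two directions of the correspondence need the triangle inequality with different argument
    orders, and symmetry as a rewrite rule would not choose among them reliably.\<close>
  have tri: "\<delta> a b \<le> \<delta> a c + \<delta> b c" "\<delta> a b \<le> \<delta> a c + \<delta> c b" "\<delta> a b \<le> \<delta> c a + \<delta> c b"
    "\<delta> a b \<le> \<delta> c b + \<delta> a c" "\<delta> a b \<le> \<delta> c b + \<delta> c a" for a b c
    using triangle[of a c b] by (auto simp: commute)
  note ne = msupport_nonempty[OF \<mu>(1) cpt(1)] msupport_nonempty[OF \<mu>(2) cpt(2)]
  have "\<exists>g. (f, g) \<in> coupled_observables \<mu> \<mu>' \<delta>" if f: "f \<in> observables" for f
  proof -
    obtain g where "g \<in> observables"
      "\<And>x y. x \<in> msupport \<mu> \<Longrightarrow> y \<in> msupport \<mu>' \<Longrightarrow> \<bar>f x - g y\<bar> \<le> \<delta> (Inl x) (Inr y)"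
      by (rule observable_extension[OF ne cpt(1) f, of "\<lambda>x y. \<delta> (Inl x) (Inr y)"])
        (simp_all add: dist tri)
    then show ?thesis
      using f by (auto simp: coupled_observables_def)
  qed
  moreover have "\<exists>f. (f, g) \<in> coupled_observables \<mu> \<mu>' \<delta>" if g: "g \<in> observables" for g
  proof -
    obtain f where "f \<in> observables"
      "\<And>y x. y \<in> msupport \<mu>' \<Longrightarrow> x \<in> msupport \<mu> \<Longrightarrow> \<bar>g y - f x\<bar> \<le> \<delta> (Inl x) (Inr y)"
      by (rule observable_extension[OF ne(2,1) cpt(2) g, of "\<lambda>y x. \<delta> (Inl x) (Inr y)"])
        (simp_all add: dist tri)
    then show ?thesis
      using g by (auto simp: coupled_observables_def abs_minus_commute)
  qed
  ultimately show ?thesis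
    by (fastforce simp: correspondences_def coupled_observables_def image_iff)
qed

section \<open>Comparing observables along a coupling of measures\<close>

lemma borel_measurable_observable:
  "f \<in> observables \<Longrightarrow> f \<in> borel_measurable borel"
  by (auto simp: observables_def intro!: borel_measurable_continuous_onI lipschitz_on_continuous_on)

text \<open>Finiteness of the cost is assumed because \<open>enn2real\<close> would turn an infinite cost into 0.\<close>

locale coupled_mm_spaces =
  fixes \<mu> :: "'a::metric_space measure" and \<mu>' :: "'b::metric_space measure"
    and p :: real and h :: "('a \<times> 'b) measure" and \<delta> :: "'a + 'b \<Rightarrow> 'a + 'b \<Rightarrow> real"
  assumes \<mu>: "mm_space \<mu>" and \<mu>': "mm_space \<mu>'"
    and cpt: "compact (UNIV :: 'a set)" and cpt': "compact (UNIV :: 'b set)"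
    and p: "p \<ge> 1"
    and h: "h \<in> measure_couplings \<mu> \<mu>'"
    and fin: "(\<integral>\<^sup>+ (x, x'). ennreal (\<delta> (Inl x) (Inr x') powr p) \<partial>h) \<noteq> \<top>"
begin

definition cost :: real where
  "cost = enn2real (\<integral>\<^sup>+ (x, x'). ennreal (\<delta> (Inl x) (Inr x') powr p) \<partial>h) powr (1 / p)"

sublocale prob_space h
  using h by (simp add: measure_couplings_def)

lemma measurable_projections:
  "fst \<in> measurable h borel" "snd \<in> measurable h borel"
proof -
  have sets: "sets h = sets borel"
    using h by (simp add: measure_couplings_def)
  have "fst \<in> measurable borel (borel :: 'a measure)" "snd \<in> measurable borel (borel :: 'b measure)"
    by (intro borel_measurable_continuous_onI continuous_on_fst continuous_on_snd continuous_on_id)+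
  then show "fst \<in> measurable h borel" "snd \<in> measurable h borel"
    using measurable_cong_sets[OF sets refl] by blast+
qed

lemma marginals: "distr h borel fst = \<mu>" "distr h borel snd = \<mu>'"
  using h by (auto simp: measure_couplings_def)

lemma AE_in_supports: "AE z in h. fst z \<in> msupport \<mu> \<and> snd z \<in> msupport \<mu>'"
proof -
  have "AE z in h. fst z \<in> msupport \<mu>"
  proof (rule AE_distrD[OF measurable_projections(1)])
    show "AE x in distr h borel fst. x \<in> msupport \<mu>"
      unfolding marginals by (rule AE_msupport[OF \<mu> cpt])
  qed
  moreover have "AE z in h. snd z \<in> msupport \<mu>'"
  proof (rule AE_distrD[OF measurable_projections(2)])
    show "AE x in distr h borel snd. x \<in> msupport \<mu>'"
      unfolding marginals by (rule AE_msupport[OF \<mu>' cpt'])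
  qed
  ultimately show ?thesis
    by eventually_elim simp
qed

text \<open>A class of functions that is closed under differences and contains the pullbacks of all
  observables, so that the integrals of the functions and of their powers converge.\<close>

definition bounded_measurable :: "('a \<times> 'b \<Rightarrow> real) set" where
  "bounded_measurable = {u. u \<in> borel_measurable h \<and> (\<exists>b. \<forall>z. \<bar>u z\<bar> \<le> b)}"

lemma pullback_bounded_measurable:
  "f \<in> observables \<Longrightarrow> (\<lambda>z. f (fst z)) \<in> bounded_measurable"
  "g \<in> observables \<Longrightarrow> (\<lambda>z. g (snd z)) \<in> bounded_measurable"
proof -
  assume f: "f \<in> observables"
  obtain b where "\<forall>x. \<bar>f x\<bar> \<le> b"
    using bounded_observable[OF f cpt] by blast
  then show "(\<lambda>z. f (fst z)) \<in> bounded_measurable"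
    using measurable_compose[OF measurable_projections(1) borel_measurable_observable[OF f]]
    unfolding bounded_measurable_def by blast
next
  assume g: "g \<in> observables"
  obtain b where "\<forall>x. \<bar>g x\<bar> \<le> b"
    using bounded_observable[OF g cpt'] by blast
  then show "(\<lambda>z. g (snd z)) \<in> bounded_measurable"
    using measurable_compose[OF measurable_projections(2) borel_measurable_observable[OF g]]
    unfolding bounded_measurable_def by blast
qed

lemma bounded_measurable_diff:
  assumes "u \<in> bounded_measurable" "v \<in> bounded_measurable"
  shows "(\<lambda>z. u z - v z) \<in> bounded_measurable"
proof -
  obtain a b where ab: "\<And>z. \<bar>u z\<bar> \<le> a" "\<And>z. \<bar>v z\<bar> \<le> b"
    using assms by (auto simp: bounded_measurable_def)
  have "\<bar>u z - v z\<bar> \<le> a + b" for z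
    using ab[of z] by linarith
  then show ?thesis
    using assms by (auto simp: bounded_measurable_def)
qed

lemma integrable_bounded_measurable:
  assumes "u \<in> bounded_measurable"
  shows "u \<in> borel_measurable h" "integrable h u" "integrable h (\<lambda>z. \<bar>u z\<bar> powr p)"
proof -
  obtain b where b: "\<And>z. \<bar>u z\<bar> \<le> b" and m: "u \<in> borel_measurable h"
    using assms by (auto simp: bounded_measurable_def)
  show "u \<in> borel_measurable h"
    by fact
  show "integrable h u"
    using b m by (intro integrable_const_bound[of _ b]) auto
  show "integrable h (\<lambda>z. \<bar>u z\<bar> powr p)"
    using b m p by (intro integrable_const_bound[of _ "b powr p"]) (auto intro!: powr_mono2)
qed

lemma Lp_norm_bounded_triangle:
  assumes "u \<in> bounded_measurable" "v \<in> bounded_measurable" "w \<in> bounded_measurable"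
  shows "Lp_norm p h (\<lambda>z. u z - w z) \<le>
    Lp_norm p h (\<lambda>z. u z - v z) + Lp_norm p h (\<lambda>z. v z - w z)"
  using Lp_norm_triangle[OF p, of h "\<lambda>z. u z - v z" "\<lambda>z. v z - w z"] assms
  by (simp add: integrable_bounded_measurable bounded_measurable_diff)

lemma coupled_Lp_norm_le_cost:
  assumes "(f, g) \<in> coupled_observables \<mu> \<mu>' \<delta>"
  shows "Lp_norm p h (\<lambda>z. f (fst z) - g (snd z)) \<le> cost"
proof -
  have "(\<lambda>z. f (fst z) - g (snd z)) \<in> bounded_measurable"
    using assms by (auto simp: coupled_observables_def
        intro: bounded_measurable_diff pullback_bounded_measurable)
  moreover have "AE z in h. \<bar>f (fst z) - g (snd z)\<bar> \<le> \<delta> (Inl (fst z)) (Inr (snd z))"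
    using AE_in_supports by eventually_elim (use assms in \<open>auto simp: coupled_observables_def\<close>)
  ultimately show ?thesis
    using Lp_norm_le_nn_integral[of p "\<lambda>z. f (fst z) - g (snd z)" h
        "\<lambda>z. \<delta> (Inl (fst z)) (Inr (snd z))"] p fin
    by (simp add: cost_def case_prod_unfold integrable_bounded_measurable)
qed

lemma obs_dist_eq_Lp_norm:
  assumes "f \<in> observables" "f2 \<in> observables"
  shows "obs_dist p \<mu> f f2 = Lp_norm p h (\<lambda>z. f (fst z) - f2 (fst z))"
proof -
  note [measurable] = assms[THEN borel_measurable_observable]
  show ?thesis
    unfolding obs_dist_def Lp_norm_def
    by (subst marginals(1)[symmetric], subst integral_distr[OF measurable_projections(1)]) auto
qed

lemma obs_dist_eq_Lp_norm':
  assumes "g \<in> observables" "g2 \<in> observables"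
  shows "obs_dist p \<mu>' g g2 = Lp_norm p h (\<lambda>z. g (snd z) - g2 (snd z))"
proof -
  note [measurable] = assms[THEN borel_measurable_observable]
  show ?thesis
    unfolding obs_dist_def Lp_norm_def
    by (subst marginals(2)[symmetric], subst integral_distr[OF measurable_projections(2)]) auto
qed

text \<open>The quadrilateral inequality: \<open>f\<close> and \<open>g\<close>, as well as \<open>f2\<close> and \<open>g2\<close>, are at distance at most the
  cost, so the sides \<open>f f2\<close> and \<open>g g2\<close> differ by at most twice the cost.\<close>

lemma obs_dist_diff_le_cost:
  assumes 1: "(f, g) \<in> coupled_observables \<mu> \<mu>' \<delta>" and 2: "(f2, g2) \<in> coupled_observables \<mu> \<mu>' \<delta>"
  shows "\<bar>obs_dist p \<mu> f f2 - obs_dist p \<mu>' g g2\<bar> \<le> 2 * cost"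
proof -
  have obs: "f \<in> observables" "f2 \<in> observables" "g \<in> observables" "g2 \<in> observables"
    using assms by (auto simp: coupled_observables_def)
  define F F2 G G2 where "F = (\<lambda>z::'a \<times> 'b. f (fst z))" and "F2 = (\<lambda>z::'a \<times> 'b. f2 (fst z))"
    and "G = (\<lambda>z::'a \<times> 'b. g (snd z))" and "G2 = (\<lambda>z::'a \<times> 'b. g2 (snd z))"
  have mem: "F \<in> bounded_measurable" "F2 \<in> bounded_measurable"
    "G \<in> bounded_measurable" "G2 \<in> bounded_measurable"
    unfolding F_def F2_def G_def G2_def using obs by (auto intro: pullback_bounded_measurable)
  define N where "N = (\<lambda>u v. Lp_norm p h (\<lambda>z. u z - v z))"
  have tri: "N u w \<le> N u v + N v w" if "u \<in> bounded_measurable"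
      "v \<in> bounded_measurable" "w \<in> bounded_measurable" for u v w
    using Lp_norm_bounded_triangle[OF that] by (simp add: N_def)
  have sym: "N u v = N v u" for u v
    unfolding N_def by (rule Lp_norm_minus_commute)
  have cost: "N F G \<le> cost" "N F2 G2 \<le> cost"
    using coupled_Lp_norm_le_cost[OF 1] coupled_Lp_norm_le_cost[OF 2]
    by (simp_all add: N_def F_def F2_def G_def G2_def)
  have "N F F2 \<le> N F G + (N G G2 + N G2 F2)"
    using tri[of F G F2] tri[of G G2 F2] mem by linarith
  moreover have "N G G2 \<le> N G F + (N F F2 + N F2 G2)"
    using tri[of G F G2] tri[of F F2 G2] mem by linarith
  ultimately have "\<bar>N F F2 - N G G2\<bar> \<le> 2 * cost"
    using cost sym[of G F] sym[of G2 F2] by linarith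
  then show ?thesis
    using obs by (simp add: obs_dist_eq_Lp_norm obs_dist_eq_Lp_norm' N_def F_def F2_def G_def G2_def)
qed

lemma obs_mean_diff_le_cost:
  assumes "(f, g) \<in> coupled_observables \<mu> \<mu>' \<delta>"
  shows "\<bar>obs_mean \<mu> f - obs_mean \<mu>' g\<bar> \<le> cost"
proof -
  have obs: "f \<in> observables" "g \<in> observables"
    using assms by (auto simp: coupled_observables_def)
  note pullback = pullback_bounded_measurable(1)[OF obs(1)] pullback_bounded_measurable(2)[OF obs(2)]
  have "obs_mean \<mu> f = (\<integral>z. f (fst z) \<partial>h)"
    unfolding obs_mean_def using borel_measurable_observable[OF obs(1)]
    by (subst marginals(1)[symmetric], subst integral_distr[OF measurable_projections(1)]) auto
  moreover have "obs_mean \<mu>' g = (\<integral>z. g (snd z) \<partial>h)"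
    unfolding obs_mean_def using borel_measurable_observable[OF obs(2)]
    by (subst marginals(2)[symmetric], subst integral_distr[OF measurable_projections(2)]) auto
  ultimately have diff: "obs_mean \<mu> f - obs_mean \<mu>' g = (\<integral>z. f (fst z) - g (snd z) \<partial>h)"
    using pullback by (simp add: integrable_bounded_measurable)
  have "\<bar>\<integral>z. f (fst z) - g (snd z) \<partial>h\<bar> \<le> Lp_norm p h (\<lambda>z. f (fst z) - g (snd z))"
    by (intro abs_expectation_le_Lp_norm p integrable_bounded_measurable bounded_measurable_diff
        pullback)
  also have "\<dots> \<le> cost"
    by (rule coupled_Lp_norm_le_cost[OF assms])
  finally show ?thesis
    unfolding diff .
qed

end

theorem theorem6p3:
  fixes \<mu> :: "'a::metric_space measure" and \<mu>' :: "'b::metric_space measure" and p :: real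
  assumes "mm_space \<mu>" and "mm_space \<mu>'"
    and "compact (UNIV :: 'a set)" and "compact (UNIV :: 'b set)"
    and "p \<ge> 1"
  shows "GH_dist observables (obs_dist p \<mu>) (obs_mean \<mu>)
                 observables (obs_dist p \<mu>') (obs_mean \<mu>')
         \<le> KS_dist p \<mu> \<mu>'"
  unfolding KS_dist_def
proof (intro INF_greatest, clarify)
  fix h \<delta>
  assume h: "h \<in> measure_couplings \<mu> \<mu>'" and \<delta>: "\<delta> \<in> metric_couplings \<mu> \<mu>'"
  define I where "I = (\<integral>\<^sup>+ (x, x'). ennreal (\<delta> (Inl x) (Inr x') powr p) \<partial>h)"
  define R where "R = coupled_observables \<mu> \<mu>' \<delta>"
  show "GH_dist observables (obs_dist p \<mu>) (obs_mean \<mu>) observables (obs_dist p \<mu>') (obs_mean \<mu>')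
      \<le> ennreal_powr I (1 / p)"
  proof (cases "I = \<top>")
    case True
    then show ?thesis
      by (simp add: ennreal_powr_def)
  next
    case False
    interpret coupled_mm_spaces \<mu> \<mu>' p h \<delta>
      using assms h False by unfold_locales (auto simp: I_def)
    have "distortion (obs_dist p \<mu>) (obs_dist p \<mu>') R \<le> ennreal (2 * cost)"
      unfolding distortion_def R_def
      by (intro SUP_least) (auto intro!: ennreal_leI obs_dist_diff_le_cost)
    moreover have "fdistortion (obs_mean \<mu>) (obs_mean \<mu>') R \<le> ennreal cost"
      unfolding fdistortion_def R_def
      by (intro SUP_least) (auto intro!: ennreal_leI obs_mean_diff_le_cost)
    ultimately have "max (distortion (obs_dist p \<mu>) (obs_dist p \<mu>') R)
        (2 * fdistortion (obs_mean \<mu>) (obs_mean \<mu>') R) \<le> ennreal cost * 2"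
      by (auto simp: ennreal_mult' mult.commute intro: mult_left_mono)
    then have "GH_dist observables (obs_dist p \<mu>) (obs_mean \<mu>)
        observables (obs_dist p \<mu>') (obs_mean \<mu>') \<le> ennreal cost * 2 / 2"
      unfolding GH_dist_def using coupled_observables_correspondence[OF assms(1-4) \<delta>]
      by (intro divide_right_mono_ennreal INF_lower2[of R]) (auto simp: R_def)
    also have "\<dots> = ennreal_powr I (1 / p)"
      using False by (simp add: mult_divide_eq_ennreal ennreal_powr_def cost_def I_def)
    finally show ?thesis .
  qed
qed

end
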